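(* Let $d\ge0$ and $a\ge1$ be integers and let $G$ be a $d$-regular graph on $n=a(d+1)$ vertices. Then \[ i(G)\ge i(aK_{d+1})=(d+2)^a. \] Indeed, for all $0\le t\le n$ we have $i_t(G)\ge i_t(aK_{d+1})=(d+1)^t\binom{a}{t}$.
   Context: Graphs are finite and simple. $i(G)$ is the number of independent sets of $G$ (including the empty set), and $i_t(G)$ is the number of independent sets of $G$ of size exactly $t$. $aK_{d+1}$ is the disjoint union of $a$ copies of the complete graph $K_{d+1}$; $\binom{a}{t}=0$ for $t>a$. *)

theory Defs
  imports "Graph_Theory.Graph_Theory"
begin

text \<open>
  Finite simple graphs are modelled by the locale \<^locale>\<open>graph\<close>: finite, loop-free symmetric
  digraphs without parallel arcs. Each undirected edge is a pair of opposite arcs, so the degree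
  of a vertex is its out-degree.
\<close>

definition regular_graph :: "nat \<Rightarrow> ('a, 'b) pre_digraph \<Rightarrow> bool" where
  "regular_graph d G \<longleftrightarrow> graph G \<and> (\<forall>v \<in> verts G. out_degree G v = d)"

definition independent_set :: "('a, 'b) pre_digraph \<Rightarrow> 'a set \<Rightarrow> bool" where
  "independent_set G S \<longleftrightarrow> S \<subseteq> verts G \<and> (\<forall>u \<in> S. \<forall>v \<in> S. \<not> u \<rightarrow>\<^bsub>G\<^esub> v)"

definition num_indep :: "('a, 'b) pre_digraph \<Rightarrow> nat" where
  "num_indep G = card {S. independent_set G S}"

definition num_indep_size :: "nat \<Rightarrow> ('a, 'b) pre_digraph \<Rightarrow> nat" where
  "num_indep_size t G = card {S. independent_set G S \<and> card S = t}"

definition complete_graph :: "nat \<Rightarrow> nat pair_pre_digraph" where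
  "complete_graph m = \<lparr> pverts = {..<m}, parcs = {(u, v). u < m \<and> v < m \<and> u \<noteq> v} \<rparr>"

text \<open>The disjoint union of \<open>a\<close> copies of \<open>H\<close>; the first component of a vertex is the index of its copy.\<close>

definition disjoint_copies :: "nat \<Rightarrow> 'a pair_pre_digraph \<Rightarrow> (nat \<times> 'a) pair_pre_digraph" where
  "disjoint_copies a H = \<lparr> pverts = {..<a} \<times> pverts H,
     parcs = {((i, u), (j, v)) | i j u v. i < a \<and> j = i \<and> (u, v) \<in> parcs H} \<rparr>"

lemma complete_digraph_complete_graph: "complete_digraph m (with_proj (complete_graph m))"
  unfolding complete_digraph_pair_def by (auto simp: complete_graph_def)

lemma pair_graph_disjoint_copies:
  assumes "pair_graph H"
  shows "pair_graph (disjoint_copies a H)"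
proof -
  interpret H: pair_graph H by fact
  have wf: "u \<in> pverts H" "v \<in> pverts H" "u \<noteq> v" "(v, u) \<in> parcs H" if "(u, v) \<in> parcs H" for u v
    using that H.wellformed' H.pair_no_loops[OF that] H.pair_sym_arcs
    by (auto simp: symmetric_def dest: symD)
  have sub: "parcs (disjoint_copies a H) \<subseteq>
      pverts (disjoint_copies a H) \<times> pverts (disjoint_copies a H)"
    by (auto simp: disjoint_copies_def dest: wf)
  have fin: "finite (pverts (disjoint_copies a H))"
    by (simp add: disjoint_copies_def H.pair_finite_verts)
  show ?thesis
  proof
    show "finite (parcs (disjoint_copies a H))"
      using sub fin by (meson finite_SigmaI finite_subset)
    show "symmetric (with_proj (disjoint_copies a H))"
      by (auto simp: symmetric_def disjoint_copies_def intro!: symI dest: wf)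
  qed (use sub fin in \<open>auto simp: disjoint_copies_def dest: wf\<close>)
qed

end

theory Submission
  imports Defs
begin

text \<open>
  Count pairs \<open>(S, v)\<close> where \<open>S\<close> is an independent set of size \<open>t\<close> and \<open>v\<close> a vertex that extends it to
  an independent set of size \<open>t + 1\<close>. In a \<open>d\<close>-regular graph the closed neighbourhood of \<open>S\<close> has at
  most \<open>t (d + 1)\<close> vertices, so \<open>(t + 1) i\<^bsub>t+1\<^esub>(G) \<ge> (n - t (d + 1)) i\<^sub>t(G)\<close>. For disjoint copies of
  the complete graph equality holds, and induction on \<open>t\<close> gives both the comparison and the formula.
\<close>

text \<open>Members of \<open>S\<close> are left out: inserting one gives back \<open>S\<close>,
  which is independent but no larger.\<close>

definition extenders :: "('a, 'b) pre_digraph \<Rightarrow> 'a set \<Rightarrow> 'a set" where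
  "extenders G S = {v \<in> verts G - S. independent_set G (insert v S)}"

lemma independent_set_subset:
  "independent_set G S \<Longrightarrow> T \<subseteq> S \<Longrightarrow> independent_set G T"
  unfolding independent_set_def by blast

lemma finite_independent_sets:
  assumes "finite (verts G)"
  shows "finite {S. independent_set G S}"
  by (rule finite_subset[of _ "Pow (verts G)"]) (use assms in \<open>auto simp: independent_set_def\<close>)

lemma independent_set_finite:
  "finite (verts G) \<Longrightarrow> independent_set G S \<Longrightarrow> finite S"
  unfolding independent_set_def by (blast intro: finite_subset)

lemma finite_extenders: "finite (verts G) \<Longrightarrow> finite (extenders G S)"
  by (simp add: extenders_def)

lemma num_indep_size_0: "finite (verts G) \<Longrightarrow> num_indep_size 0 G = 1"
proof -
  assume fin: "finite (verts G)"
  have "{S. independent_set G S \<and> card S = 0} = {{}}"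
    using independent_set_finite[OF fin] by (auto simp: independent_set_def)
  then show ?thesis by (simp add: num_indep_size_def)
qed

lemma num_indep_eq_sum:
  assumes "finite (verts G)"
  shows "num_indep G = (\<Sum>t\<le>card (verts G). num_indep_size t G)"
proof -
  have "{S. independent_set G S} = (\<Union>t\<le>card (verts G). {S. independent_set G S \<and> card S = t})"
    using assms by (auto simp: independent_set_def card_mono)
  moreover have "card \<dots> = (\<Sum>t\<le>card (verts G). card {S. independent_set G S \<and> card S = t})"
    by (rule card_UN_disjoint)
      (auto intro: finite_subset[OF _ finite_independent_sets[OF assms]])
  ultimately show ?thesis
    by (simp add: num_indep_def num_indep_size_def)
qed

text \<open>Double counting: a pair of a \<open>t\<close>-set and an extender is the same as an
  independent set of size \<open>Suc t\<close> with one marked element, and each such set can be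
  marked in \<open>Suc t\<close> ways.\<close>

lemma Suc_mult_num_indep_size:
  assumes fin: "finite (verts G)"
  shows "Suc t * num_indep_size (Suc t) G
    = (\<Sum>S | independent_set G S \<and> card S = t. card (extenders G S))"
proof -
  let ?I = "\<lambda>t. {S. independent_set G S \<and> card S = t}"
  have finI: "finite (?I k)" for k
    by (rule finite_subset[OF _ finite_independent_sets[OF fin]]) auto
  \<comment> \<open>Keeping \<open>v\<close> as second component makes the map invertible: deleting
    the marked vertex recovers \<open>S\<close>.\<close>
  have "bij_betw (\<lambda>(S, v). (insert v S, v)) (Sigma (?I t) (extenders G)) (SIGMA T:?I (Suc t). T)"
  proof (rule bij_betw_byWitness[where f' = "\<lambda>(T, v). (T - {v}, v)"])
    show "(\<lambda>(S, v). (insert v S, v)) ` Sigma (?I t) (extenders G) \<subseteq> (SIGMA T:?I (Suc t). T)"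
      by (auto simp: extenders_def independent_set_finite[OF fin])
    show "(\<lambda>(T, v). (T - {v}, v)) ` (SIGMA T:?I (Suc t). T) \<subseteq> Sigma (?I t) (extenders G)"
      by (auto simp: extenders_def insert_absorb independent_set_finite[OF fin]
          intro: independent_set_subset) (auto simp: independent_set_def)
  qed (auto simp: extenders_def)
  then have "card (Sigma (?I t) (extenders G)) = card (SIGMA T:?I (Suc t). T)"
    by (rule bij_betw_same_card)
  also have "\<dots> = (\<Sum>T\<in>?I (Suc t). card T)"
    using finI independent_set_finite[OF fin] by (intro card_SigmaI) auto
  also have "\<dots> = Suc t * num_indep_size (Suc t) G"
    by (simp add: num_indep_size_def)
  finally show ?thesis
    using finI finite_extenders[OF fin] by (simp add: card_SigmaI)
qed

lemma regular_graph_finite_verts: "regular_graph d G \<Longrightarrow> finite (verts G)"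
  by (simp add: regular_graph_def graph_def digraph_def fin_digraph.finite_verts)

text \<open>A vertex fails to extend \<open>S\<close> only if it lies in the closed neighbourhood of
  a member of \<open>S\<close>, and each such neighbourhood has at most \<open>d + 1\<close>
  vertices. The subtraction truncates at 0, where the bound is trivial.\<close>

lemma card_extenders_ge:
  assumes G: "regular_graph d G" and S: "independent_set G S"
  shows "card (verts G) - card S * (d + 1) \<le> card (extenders G S)"
proof -
  interpret graph G using G by (simp add: regular_graph_def)
  have finS: "finite S" using independent_set_finite[OF _ S] by simp
  have SV: "S \<subseteq> verts G" using S by (simp add: independent_set_def)
  \<comment> \<open>The closed neighbourhood of \<open>u\<close>; arcs come in opposite pairs, so
    heads of out-arcs give all neighbours.\<close>
  let ?N = "\<lambda>u. insert u (head G ` out_arcs G u)"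
  have finN: "finite (?N u)" for u by (simp add: finite_out_arcs)
  have "card (?N u) \<le> d + 1" if "u \<in> S" for u
  proof -
    have "card (head G ` out_arcs G u) \<le> out_degree G u"
      unfolding out_degree_def by (rule card_image_le[OF finite_out_arcs])
    also have "\<dots> = d" using G SV that by (auto simp: regular_graph_def)
    finally show ?thesis by (simp add: card_insert_if finite_out_arcs)
  qed
  then have "(\<Sum>u\<in>S. card (?N u)) \<le> card S * (d + 1)"
    using sum_bounded_above[of S "\<lambda>u. card (?N u)" "d + 1"] by simp
  then have cardN: "card (\<Union>u\<in>S. ?N u) \<le> card S * (d + 1)"
    using card_UN_le[OF finS, of ?N] by linarith
  have nbr: "v \<in> ?N u" if "u \<rightarrow>\<^bsub>G\<^esub> v" for u v
    using that by (force simp: arcs_ends_conv)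
  have loop: "\<not> v \<rightarrow>\<^bsub>G\<^esub> v" for v
    using adj_not_same by blast
  have "verts G \<subseteq> extenders G S \<union> (\<Union>u\<in>S. ?N u)"
  proof
    fix v assume v: "v \<in> verts G"
    show "v \<in> extenders G S \<union> (\<Union>u\<in>S. ?N u)"
    proof (cases "v \<in> (\<Union>u\<in>S. ?N u)")
      case False
      then have "v \<notin> S" "\<And>u. u \<in> S \<Longrightarrow> \<not> u \<rightarrow>\<^bsub>G\<^esub> v" using nbr by blast+
      \<comment> \<open>Being outside every \<open>?N u\<close> excludes only arcs from
        \<open>S\<close> to \<open>v\<close>; symmetry excludes the reverse arcs.\<close>
      moreover from this have "\<And>u. u \<in> S \<Longrightarrow> \<not> v \<rightarrow>\<^bsub>G\<^esub> u" using graph_symmetric by blast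
      ultimately have "v \<in> extenders G S"
        using v S loop by (auto simp: extenders_def independent_set_def)
      then show ?thesis by simp
    qed simp
  qed
  then have "card (verts G) \<le> card (extenders G S \<union> (\<Union>u\<in>S. ?N u))"
    using finS finN finite_extenders[of G S] by (intro card_mono) auto
  also have "\<dots> \<le> card (extenders G S) + card (\<Union>u\<in>S. ?N u)"
    by (rule card_Un_le)
  finally show ?thesis using cardN by linarith
qed

text \<open>An independent set meets each clique at most once, so it occupies \<open>card S\<close>
  copies, and the extenders are exactly the vertices of the other copies.\<close>

lemma card_extenders_disjoint_copies_complete:
  fixes a m :: nat
  defines "H \<equiv> with_proj (disjoint_copies a (complete_graph m))"
  assumes S: "independent_set H S"
  shows "card (extenders H S) = (a - card S) * m"
proof -
  have V: "verts H = {..<a} \<times> {..<m}"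
    by (simp add: H_def disjoint_copies_def complete_graph_def)
  have adj: "(i, u) \<rightarrow>\<^bsub>H\<^esub> (j, v) \<longleftrightarrow> i < a \<and> j = i \<and> u < m \<and> v < m \<and> u \<noteq> v" for i j u v
    by (auto simp: H_def disjoint_copies_def complete_graph_def arcs_ends_def arc_to_ends_def)
  have SV: "S \<subseteq> {..<a} \<times> {..<m}" using S V by (simp add: independent_set_def)
  have indep: "\<not> (i, u) \<rightarrow>\<^bsub>H\<^esub> (j, v)" if "(i, u) \<in> S" "(j, v) \<in> S" for i u j v
    using S that by (auto simp: independent_set_def)
  \<comment> \<open>Two distinct vertices of \<open>S\<close> with the same copy index would be
    adjacent.\<close>
  have inj: "inj_on fst S"
    using SV indep by (fastforce simp: inj_on_def adj)
  have "extenders H S = ({..<a} - fst ` S) \<times> {..<m}"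
  proof (intro set_eqI iffI)
    fix x assume x: "x \<in> extenders H S"
    obtain i u where [simp]: "x = (i, u)" by fastforce
    have "i \<notin> fst ` S"
    proof
      assume "i \<in> fst ` S"
      then obtain v where v: "(i, v) \<in> S" by force
      with x have "\<not> (i, u) \<rightarrow>\<^bsub>H\<^esub> (i, v)" "u \<noteq> v"
        by (auto simp: extenders_def independent_set_def)
      then show False using x v SV V by (auto simp: adj extenders_def)
    qed
    then show "x \<in> ({..<a} - fst ` S) \<times> {..<m}"
      using x by (auto simp: extenders_def V)
  next
    fix x assume x: "x \<in> ({..<a} - fst ` S) \<times> {..<m}"
    obtain i u where [simp]: "x = (i, u)" by fastforce
    have "x \<notin> S" using x by force
    moreover have "j \<noteq> i" if "(j, v) \<in> S" for j v using x that by force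
    ultimately show "x \<in> extenders H S"
      using x S SV by (fastforce simp: extenders_def independent_set_def V adj)
  qed
  moreover have "fst ` S \<subseteq> {..<a}" using SV by auto
  ultimately show ?thesis
    by (simp add: card_cartesian_product card_Diff_subset finite_subset[of "fst ` S"]
        card_image[OF inj])
qed

text \<open>The closed formula satisfies the recurrence of the extender count, with the same factor
  \<open>(a - t) * m\<close>. Truncation is harmless: for \<open>t\<close> \<ge> \<open>a\<close>
  both sides vanish.\<close>

lemma Suc_mult_power_choose:
  fixes a m t :: nat
  shows "Suc t * (m ^ Suc t * (a choose Suc t)) = (a - t) * m * (m ^ t * (a choose t))"
proof -
  have "Suc t * (a choose Suc t) = (a - t) * (a choose t)"
    \<comment> \<open>Both sides equal \<open>a * ((a - 1) choose t)\<close>.\<close>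
    using binomial_absorb_comp[of a t] binomial_absorption[of t a] by simp
  then have "Suc t * (a choose Suc t) * m ^ Suc t = (a - t) * (a choose t) * m ^ Suc t" by simp
  then show ?thesis by (simp only: power_Suc ac_simps)
qed

text \<open>Here the number of extenders depends only on the size of the set, so double counting
  becomes an exact recurrence in \<open>t\<close>.\<close>

lemma num_indep_size_disjoint_copies_complete:
  fixes a m t :: nat
  shows "num_indep_size t (with_proj (disjoint_copies a (complete_graph m))) = m ^ t * (a choose t)"
proof -
  let ?H = "with_proj (disjoint_copies a (complete_graph m))"
  have fin: "finite (verts ?H)"
    by (simp add: disjoint_copies_def complete_graph_def)
  show ?thesis
  proof (induction t)
    case 0
    show ?case using num_indep_size_0[OF fin] by simp
  next
    case (Suc t)
    have "Suc t * num_indep_size (Suc t) ?H = (a - t) * m * num_indep_size t ?H"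
      unfolding Suc_mult_num_indep_size[OF fin]
      by (simp add: card_extenders_disjoint_copies_complete num_indep_size_def)
    also have "\<dots> = Suc t * (m ^ Suc t * (a choose Suc t))"
      by (simp only: Suc.IH Suc_mult_power_choose)
    finally show ?case by (simp only: mult_cancel1) simp
  qed
qed

lemma num_indep_disjoint_copies_complete:
  assumes "m \<ge> 1"
  shows "num_indep (with_proj (disjoint_copies a (complete_graph m))) = (m + 1) ^ a"
proof -
  let ?H = "with_proj (disjoint_copies a (complete_graph m))"
  have fin: "finite (verts ?H)" and card: "card (verts ?H) = a * m"
    by (simp_all add: disjoint_copies_def complete_graph_def card_cartesian_product)
  have "num_indep ?H = (\<Sum>t\<le>a * m. m ^ t * (a choose t))"
    by (simp only: num_indep_eq_sum[OF fin] card num_indep_size_disjoint_copies_complete)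
  also have "\<dots> = (\<Sum>t\<le>a. m ^ t * (a choose t))"
    \<comment> \<open>Since \<open>m\<close> \<ge> 1, the range up to \<open>a * m\<close> includes
      all \<open>t\<close> \<le> \<open>a\<close>; the terms beyond \<open>a\<close> have binomial
      coefficient 0.\<close>
    using assms by (intro sum.mono_neutral_right) auto
  also have "\<dots> = (m + 1) ^ a"
    using binomial[of m 1 a] by (simp add: mult.commute)
  finally show ?thesis .
qed

lemma num_indep_size_regular_ge:
  assumes G: "regular_graph d G" and card: "card (verts G) = a * (d + 1)"
  shows "(d + 1) ^ t * (a choose t) \<le> num_indep_size t G"
  supply fin = regular_graph_finite_verts[OF G]
proof (induction t)
  case 0
  show ?case using num_indep_size_0[OF fin] by simp
next
  case (Suc t)
  have "Suc t * ((d + 1) ^ Suc t * (a choose Suc t))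
      = (a - t) * (d + 1) * ((d + 1) ^ t * (a choose t))"
    by (rule Suc_mult_power_choose)
  also have "\<dots> \<le> (a - t) * (d + 1) * num_indep_size t G"
    by (rule mult_le_mono2[OF Suc.IH])
  also have "\<dots> = (\<Sum>S | independent_set G S \<and> card S = t. (a - t) * (d + 1))"
    by (simp add: num_indep_size_def)
  \<comment> \<open>As \<open>card (verts G)\<close> is \<open>a * (d + 1)\<close>, the lower bound
    on extenders of a \<open>t\<close>-set factors as \<open>(a - t) * (d + 1)\<close>.\<close>
  also have "\<dots> \<le> (\<Sum>S | independent_set G S \<and> card S = t. card (extenders G S))"
    using card_extenders_ge[OF G] by (intro sum_mono)
      (auto simp only: card diff_mult_distrib mem_Collect_eq)
  also have "\<dots> = Suc t * num_indep_size (Suc t) G"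
    by (rule Suc_mult_num_indep_size[OF fin, symmetric])
  finally show ?case by (simp only: Suc_mult_le_cancel1)
qed

theorem theorem2p1:
  fixes G :: "('a, 'b) pre_digraph" and d a n :: nat
  assumes "a \<ge> 1"
    and "regular_graph d G"
    and "n = a * (d + 1)"
    and "card (verts G) = n"
  shows "num_indep G \<ge> num_indep (with_proj (disjoint_copies a (complete_graph (d + 1))))
    \<and> num_indep (with_proj (disjoint_copies a (complete_graph (d + 1)))) = (d + 2) ^ a
    \<and> (\<forall>t. 0 \<le> t \<and> t \<le> n \<longrightarrow>
         num_indep_size t G
           \<ge> num_indep_size t (with_proj (disjoint_copies a (complete_graph (d + 1))))
         \<and> num_indep_size t (with_proj (disjoint_copies a (complete_graph (d + 1))))
           = (d + 1) ^ t * (a choose t))"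
proof (intro conjI allI impI)
  let ?H = "with_proj (disjoint_copies a (complete_graph (d + 1)))"
  have card: "card (verts G) = a * (d + 1)" using assms by simp
  have finG: "finite (verts G)"
    by (rule regular_graph_finite_verts[OF assms(2)])
  have finH: "finite (verts ?H)" and cardH: "card (verts ?H) = a * (d + 1)"
    by (simp_all add: disjoint_copies_def complete_graph_def card_cartesian_product)
  \<comment> \<open>Proved for every \<open>t\<close>, so that it also serves as the termwise bound
    for the total count.\<close>
  show ge: "num_indep_size t ?H \<le> num_indep_size t G" for t
    unfolding num_indep_size_disjoint_copies_complete
    by (rule num_indep_size_regular_ge[OF assms(2) card])
  \<comment> \<open>Both graphs have \<open>a * (d + 1)\<close> vertices, so the two sums over sizes
    have the same range.\<close>
  show "num_indep ?H \<le> num_indep G"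
    unfolding num_indep_eq_sum[OF finG] num_indep_eq_sum[OF finH] card cardH
    by (rule sum_mono) (rule ge)
  show "num_indep ?H = (d + 2) ^ a"
    using num_indep_disjoint_copies_complete[of "d + 1" a] by simp
  show "num_indep_size t ?H = (d + 1) ^ t * (a choose t)" for t
    by (rule num_indep_size_disjoint_copies_complete)
qed

end
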